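(* If $F\in C^\infty(\mathfrak M)^{\mathrm U(n)\times\mathrm U(n)}$ and $f=F\circ\iota$, then at every $(e^q,J)\in\mathfrak M_0^{\mathrm{reg}}$, $$\nabla_1F(e^q,J)=[d_2f(e^q,J),J]^++\nabla_1f(e^q,J)+R(q)[d_2f(e^q,J),J]^+ .$$
   Context: $G=\mathrm{GL}(n,\mathbb C)$ (real Lie group), $\mathcal G=\mathfrak{gl}(n,\mathbb C)$ (real Lie algebra) with $\langle X,Y\rangle=\Re\operatorname{tr}(XY)$. Let $\mathcal G^+=\mathfrak u(n)$ (anti-Hermitian matrices) and $\mathcal G^-=\mathrm i\,\mathfrak u(n)$ (Hermitian matrices); every $X\in\mathcal G$ decomposes as $X=X^++X^-$ with $X^+=\frac12(X-X^* )\in\mathcal G^+$, $X^-=\frac12(X+X^* )\in\mathcal G^-$; $\mathcal G^\pm_0$ denotes the diagonal matrices in $\mathcal G^\pm$. $\mathfrak M=G\times\mathcal G$; for $F\in C^\infty(\mathfrak M,\mathbb R)$, $\langle\nabla_1F(g,J),X\rangle=\frac{d}{dt}|_{0}F(e^{tX}g,J)$ for all $X\in\mathcal G$. For $\eta\in\mathrm U(n)$, $\mathcal R_\eta(g,J)=(g\eta^{-1},J)$, $\mathcal L_\eta(g,J)=(\eta g,\eta J\eta^{-1})$; $C^\infty(\mathfrak M)^{\mathrm U(n)\times\mathrm U(n)}$ is the set of smooth real functions invariant under all $\mathcal R_\eta$ and all $\mathcal L_\eta$. Let $\mathfrak M_0^{\mathrm{reg}}=\{(e^q,J): J\in\mathcal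 G,\ q=\mathrm{diag}(q_1,\dots,q_n),\ q_i\in\mathbb R,\ q_1>q_2>\dots>q_n\}\subset\mathfrak M$ with inclusion $\iota$. For $f\in C^\infty(\mathfrak M_0^{\mathrm{reg}})$ define $\nabla_1f\in\mathcal G^-_0$ and $d_2f\in\mathcal G$ by $\langle\nabla_1f(e^q,J),X_0\rangle=\frac{d}{dt}|_0f(e^{q+tX_0},J)$ for all $X_0\in\mathcal G^-_0$ and $\langle d_2f(e^q,J),X\rangle=\frac{d}{dt}|_0f(e^q,J+tX)$ for all $X\in\mathcal G$. $R(q)\in\mathrm{End}(\mathcal G)$ is defined by $(R(q)X)_{ii}=0$, $(R(q)X)_{ij}=X_{ij}\coth(q_i-q_j)$ for $i\neq j$. *)

theory Defs
  imports "HOL-Analysis.Analysis"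
begin

text \<open>Complex n x n matrices, viewed as a real vector space (gl(n,C)).\<close>
type_synonym 'n cmat = "((complex, 'n) vec, 'n) vec"
type_synonym 'n rvec = "(real, 'n) vec"

text \<open>C-infinity smoothness on an open set: Frechet differentiable at every point,
  and every directional derivative function is again smooth (coinductively).\<close>
coinductive smooth_on :: "'a::real_normed_vector set \<Rightarrow> ('a \<Rightarrow> 'b::real_normed_vector) \<Rightarrow> bool"
  for S where
  "\<lbrakk> \<forall>x\<in>S. (f has_derivative f' x) (at x); \<forall>v. smooth_on S (\<lambda>x. f' x v) \<rbrakk> \<Longrightarrow> smooth_on S f"

fun mpow :: "'n::finite cmat \<Rightarrow> nat \<Rightarrow> 'n cmat" where
  "mpow X 0 = mat 1"
| "mpow X (Suc k) = X ** mpow X k"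

text \<open>Matrix exponential (power series).\<close>
definition mexp :: "'n::finite cmat \<Rightarrow> 'n cmat" where
  "mexp X = (\<Sum>k. (1 / fact k) *\<^sub>R mpow X k)"

text \<open>Conjugate transpose.\<close>
definition adj :: "'n::finite cmat \<Rightarrow> 'n cmat" where
  "adj X = (\<chi> i j. cnj (X $ j $ i))"

definition mtrace :: "'n::finite cmat \<Rightarrow> complex" where
  "mtrace X = (\<Sum>i\<in>UNIV. X $ i $ i)"

text \<open>The pairing <X,Y> = Re tr(XY).\<close>
definition pair :: "'n::finite cmat \<Rightarrow> 'n cmat \<Rightarrow> real" where
  "pair X Y = Re (mtrace (X ** Y))"

definition comm :: "'n::finite cmat \<Rightarrow> 'n cmat \<Rightarrow> 'n cmat" where
  "comm X Y = X ** Y - Y ** X"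

text \<open>Anti-Hermitian part X^+ = (X - X^*)/2.\<close>
definition pplus :: "'n::finite cmat \<Rightarrow> 'n cmat" where
  "pplus X = (1/2::real) *\<^sub>R (X - adj X)"

text \<open>Unitary group U(n).\<close>
definition unitary :: "'n::finite cmat set" where
  "unitary = {\<eta>. \<eta> ** adj \<eta> = mat 1 \<and> adj \<eta> ** \<eta> = mat 1}"

text \<open>The manifold M = GL(n,C) x gl(n,C).\<close>
definition MM :: "('n::finite cmat \<times> 'n cmat) set" where
  "MM = {(g, J). invertible g}"

text \<open>Smooth real functions on M invariant under all R_eta and L_eta, eta in U(n)
  (eta^{-1} = eta^* for unitary eta).\<close>
definition inv_smooth :: "('n::finite cmat \<times> 'n cmat \<Rightarrow> real) set" where
  "inv_smooth = {F. smooth_on MM F \<and>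
     (\<forall>\<eta>\<in>unitary. \<forall>(g, J)\<in>MM.
        F (g ** adj \<eta>, J) = F (g, J) \<and> F (\<eta> ** g, \<eta> ** J ** adj \<eta>) = F (g, J))}"

text \<open>Gradient nabla_1 F(g,J) in gl(n,C).\<close>
definition nabla1 :: "('n::finite cmat \<times> 'n cmat \<Rightarrow> real) \<Rightarrow> 'n cmat \<Rightarrow> 'n cmat \<Rightarrow> 'n cmat" where
  "nabla1 F g J = (THE Y. \<forall>X. ((\<lambda>t. F (mexp (t *\<^sub>R X) ** g, J)) has_real_derivative pair Y X) (at 0))"

text \<open>Real diagonal matrix diag(q) (element of G_0^-), q in R^n.\<close>
definition dmat :: "real^'n \<Rightarrow> 'n::finite cmat" where
  "dmat q = (\<chi> i j. if i = j then complex_of_real (q $ i) else 0)"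

text \<open>G_0^-: diagonal Hermitian matrices.\<close>
definition diagH :: "'n::finite cmat set" where
  "diagH = range dmat"

text \<open>Regularity: q_1 > q_2 > ... > q_n w.r.t. the order of the index type.\<close>
definition regular :: "real^'n::{finite,linorder} \<Rightarrow> bool" where
  "regular q \<longleftrightarrow> (\<forall>i j. i < j \<longrightarrow> q $ i > q $ j)"

text \<open>For f on M_0^reg, written as f q J = f(e^q, J):
  nabla_1 f in G_0^- and d_2 f in gl(n,C).\<close>
definition nabla1_0 :: "(real^'n \<Rightarrow> 'n cmat \<Rightarrow> real) \<Rightarrow> real^'n \<Rightarrow> 'n::finite cmat \<Rightarrow> 'n cmat" where
  "nabla1_0 f q J = (THE Y. Y \<in> diagH \<and>
     (\<forall>x. ((\<lambda>t. f (q + t *\<^sub>R x) J) has_real_derivative pair Y (dmat x)) (at 0)))"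

definition d2 :: "(real^'n \<Rightarrow> 'n cmat \<Rightarrow> real) \<Rightarrow> real^'n \<Rightarrow> 'n::finite cmat \<Rightarrow> 'n cmat" where
  "d2 f q J = (THE Y. \<forall>X. ((\<lambda>t. f q (J + t *\<^sub>R X)) has_real_derivative pair Y X) (at 0))"

definition coth :: "real \<Rightarrow> real" where
  "coth x = cosh x / sinh x"

definition Rq :: "real^'n \<Rightarrow> 'n::finite cmat \<Rightarrow> 'n cmat" where
  "Rq q X = (\<chi> i j. if i = j then 0 else X $ i $ j * complex_of_real (coth (q $ i - q $ j)))"

end

theory Submission
  imports Defs
begin

(* Write g = e^q and let L be the derivative of F at (g, J). Through the nondegenerate pairing
  Re tr (X Y), the partial derivatives X |-> L (X g, 0) and X |-> L (0, X) are represented by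
  matrices Z and Y; these are nabla_1 F and d_2 f, and the real diagonal of Z is nabla_1 f.
  Differentiating the two U(n)-invariances along one-parameter groups e^(t W), W anti-Hermitian,
  gives Z^+ = [Y, J]^+ (left invariance) and (g^-1 Z g)^+ = 0 (right invariance). Entrywise, for
  i ~= j these say Z_ij - conj Z_ji = 2 [Y, J]^+_ij and e^(q_j - q_i) Z_ij = e^(q_i - q_j) conj Z_ji,
  whose solution is Z_ij = [Y, J]^+_ij (1 + coth (q_i - q_j)); on the diagonal they fix the
  imaginary part of Z and leave its real part, nabla_1 f, free. *)

section \<open>Bounded endomorphisms as a Banach algebra\<close>

(* Matrix multiplication is not the type class product, so the matrices form no instance of
  real_normed_algebra_1. Bounded endomorphisms under composition do, and left multiplication lmul
  embeds the matrices into them; this is how mexp inherits the library theory of exp. *)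

typedef (overloaded) 'a endo = "UNIV :: ('a::real_normed_vector \<Rightarrow>\<^sub>L 'a) set"
  by simp

setup_lifting type_definition_endo

instantiation endo :: ("{real_normed_vector, perfect_space}") real_normed_algebra_1
begin

lift_definition zero_endo :: "'a endo" is 0 .
lift_definition one_endo :: "'a endo" is id_blinfun .
lift_definition plus_endo :: "'a endo \<Rightarrow> 'a endo \<Rightarrow> 'a endo" is "(+)" .
lift_definition minus_endo :: "'a endo \<Rightarrow> 'a endo \<Rightarrow> 'a endo" is "(-)" .
lift_definition uminus_endo :: "'a endo \<Rightarrow> 'a endo" is uminus .
lift_definition scaleR_endo :: "real \<Rightarrow> 'a endo \<Rightarrow> 'a endo" is scaleR .
lift_definition times_endo :: "'a endo \<Rightarrow> 'a endo \<Rightarrow> 'a endo" is "(o\<^sub>L)" .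
lift_definition norm_endo :: "'a endo \<Rightarrow> real" is norm .
definition dist_endo :: "'a endo \<Rightarrow> 'a endo \<Rightarrow> real" where "dist_endo x y = norm (x - y)"
definition sgn_endo :: "'a endo \<Rightarrow> 'a endo" where "sgn_endo x = inverse (norm x) *\<^sub>R x"
definition uniformity_endo :: "('a endo \<times> 'a endo) filter"
  where "uniformity_endo = (INF e\<in>{0<..}. principal {(x, y). dist x y < e})"
definition open_endo :: "'a endo set \<Rightarrow> bool"
  where "open_endo U = (\<forall>x\<in>U. \<forall>\<^sub>F (x', y) in uniformity. x' = x \<longrightarrow> y \<in> U)"

instance
proof
  fix a b c :: "'a endo" and r s :: real
  show "dist a b = norm (a - b)"
    by (simp add: dist_endo_def)
  show "sgn a = inverse (norm a) *\<^sub>R a"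
    by (simp add: sgn_endo_def)
  show "(uniformity :: ('a endo \<times> 'a endo) filter) =
      (INF e\<in>{0<..}. principal {(x, y). dist x y < e})"
    by (simp add: uniformity_endo_def)
  show "open U = (\<forall>x\<in>U. \<forall>\<^sub>F (x', y) in uniformity. x' = x \<longrightarrow> y \<in> U)" for U :: "'a endo set"
    by (simp add: open_endo_def)
  show "a + b + c = a + (b + c)" and "a + b = b + a" and "0 + a = a" and "- a + a = 0"
    and "a - b = a + - b" and "r *\<^sub>R s *\<^sub>R a = (r * s) *\<^sub>R a" and "1 *\<^sub>R a = a"
    and "norm a = 0 \<longleftrightarrow> a = 0" and "norm (r *\<^sub>R a) = \<bar>r\<bar> * norm a"
    and "norm (1 :: 'a endo) = 1"
    by (transfer; simp)+
  show "r *\<^sub>R (a + b) = r *\<^sub>R a + r *\<^sub>R b" and "(r + s) *\<^sub>R a = r *\<^sub>R a + s *\<^sub>R a"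
    by (transfer; simp add: scaleR_add_right scaleR_add_left)+
  show "norm (a + b) \<le> norm a + norm b"
    by transfer (rule norm_triangle_ineq)
  show "norm (a * b) \<le> norm a * norm b"
    by transfer (rule norm_blinfun_compose)
  show "a * b * c = a * (b * c)" and "1 * a = a" and "a * 1 = a"
    and "(a + b) * c = a * c + b * c" and "a * (b + c) = a * b + a * c"
    and "r *\<^sub>R a * b = r *\<^sub>R (a * b)" and "a * r *\<^sub>R b = r *\<^sub>R (a * b)"
    by (transfer; rule blinfun_eqI;
        simp add: blinfun.add_left blinfun.add_right blinfun.scaleR_left blinfun.scaleR_right)+
  show "(0 :: 'a endo) \<noteq> 1"
    by transfer (metis norm_blinfun_id norm_zero zero_neq_one)
qed

end

instance endo :: ("{banach, perfect_space}") banach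
proof
  fix X :: "nat \<Rightarrow> 'a endo"
  assume "Cauchy X"
  then have "Cauchy (\<lambda>n. Rep_endo (X n))"
    by (simp add: Cauchy_def dist_endo_def dist_norm norm_endo.rep_eq minus_endo.rep_eq)
  then obtain L where "(\<lambda>n. Rep_endo (X n)) \<longlonglongrightarrow> L"
    by (auto simp: Cauchy_convergent_iff convergent_def)
  then have "X \<longlonglongrightarrow> Abs_endo L"
    by (simp add: LIMSEQ_def dist_endo_def dist_norm norm_endo.rep_eq minus_endo.rep_eq Abs_endo_inverse)
  then show "convergent X"
    by (auto simp: convergent_def)
qed

section \<open>The matrix exponential\<close>

lemma matrix_scaleR_mult_left:
  fixes A :: "'a::real_algebra_1 ^ 'm ^ 'n" and B :: "'a ^ 'p ^ 'm"
  shows "(c *\<^sub>R A) ** B = c *\<^sub>R (A ** B)"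
  by (simp add: matrix_matrix_mult_def vec_eq_iff scaleR_sum_right)

lemma matrix_scaleR_mult_right:
  fixes A :: "'a::real_algebra_1 ^ 'm ^ 'n" and B :: "'a ^ 'p ^ 'm"
  shows "A ** (c *\<^sub>R B) = c *\<^sub>R (A ** B)"
  by (simp add: matrix_matrix_mult_def vec_eq_iff scaleR_sum_right)

lemma matrix_add_rdistrib:
  fixes A B :: "'a::semiring_1 ^ 'm ^ 'n" and C :: "'a ^ 'p ^ 'm"
  shows "(A + B) ** C = A ** C + B ** C"
  by (vector matrix_matrix_mult_def sum.distrib[symmetric] field_simps)

lemma bounded_bilinear_matrix_mult:
  "bounded_bilinear
    ((**) :: 'a::{real_algebra_1, euclidean_space} ^ 'm ^ 'n \<Rightarrow> 'a ^ 'p ^ 'm \<Rightarrow> 'a ^ 'p ^ 'n)"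
  unfolding bilinear_conv_bounded_bilinear[symmetric] bilinear_def
  by (auto intro!: linearI simp: matrix_add_ldistrib matrix_add_rdistrib
      matrix_scaleR_mult_left matrix_scaleR_mult_right)

lemmas bounded_linear_matrix_mult_left =
  bounded_bilinear.bounded_linear_left[OF bounded_bilinear_matrix_mult]
lemmas bounded_linear_matrix_mult_right =
  bounded_bilinear.bounded_linear_right[OF bounded_bilinear_matrix_mult]

lift_definition lmul :: "'n::finite cmat \<Rightarrow> 'n cmat endo" is "\<lambda>A. Blinfun (\<lambda>B. A ** B)" .

lemma blinfun_apply_lmul [simp]: "blinfun_apply (Rep_endo (lmul A)) B = A ** B"
  by (simp add: lmul.rep_eq bounded_linear_Blinfun_apply bounded_linear_matrix_mult_right)

definition apply_to_one :: "'n::finite cmat endo \<Rightarrow> 'n cmat" where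
  "apply_to_one T = blinfun_apply (Rep_endo T) (mat 1)"

lemma apply_to_one_lmul [simp]: "apply_to_one (lmul A) = A"
  by (simp add: apply_to_one_def)

lemma lmul_inject: "lmul A = lmul B \<longleftrightarrow> A = B"
  by (metis apply_to_one_lmul)

lemma lmul_mult: "lmul (A ** B) = lmul A * lmul B"
  by transfer (rule blinfun_eqI, simp add: bounded_linear_Blinfun_apply
      bounded_linear_matrix_mult_right matrix_mul_assoc)

lemma lmul_one: "lmul (mat 1) = 1"
  by transfer
    (rule blinfun_eqI, simp add: bounded_linear_Blinfun_apply bounded_linear_matrix_mult_right)

lemma bounded_linear_lmul: "bounded_linear lmul"
proof -
  have "linear lmul"
    by (rule linearI; transfer; rule blinfun_eqI)
      (simp_all add: bounded_linear_Blinfun_apply bounded_linear_matrix_mult_right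
        blinfun.add_left blinfun.scaleR_left matrix_add_rdistrib matrix_scaleR_mult_left)
  then show ?thesis
    by (simp add: linear_conv_bounded_linear)
qed

lemma bounded_linear_apply_to_one: "bounded_linear apply_to_one"
proof (rule bounded_linear_intro[where K = "norm (mat 1 :: 'n::finite cmat)"])
  fix S T :: "'n::finite cmat endo" and r :: real
  show "apply_to_one (S + T) = apply_to_one S + apply_to_one T"
    by (simp add: apply_to_one_def plus_endo.rep_eq blinfun.add_left)
  show "apply_to_one (r *\<^sub>R S) = r *\<^sub>R apply_to_one S"
    by (simp add: apply_to_one_def scaleR_endo.rep_eq blinfun.scaleR_left)
  show "norm (apply_to_one S) \<le> norm S * norm (mat 1 :: 'n cmat)"
    by (simp add: apply_to_one_def norm_endo.rep_eq norm_blinfun)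
qed

lemma lmul_mpow: "lmul (mpow A k) = lmul A ^ k"
  by (induction k) (simp_all add: lmul_one lmul_mult)

lemma mexp_sums: "(\<lambda>k. (1 / fact k) *\<^sub>R mpow A k) sums mexp A"
proof -
  have "(\<lambda>k. apply_to_one (lmul A ^ k /\<^sub>R fact k)) sums apply_to_one (exp (lmul A))"
    by (rule bounded_linear.sums[OF bounded_linear_apply_to_one exp_converges])
  moreover have "apply_to_one (lmul A ^ k /\<^sub>R fact k) = (1 / fact k) *\<^sub>R mpow A k" for k
    by (simp add: linear_simps(5)[OF bounded_linear_apply_to_one] lmul_mpow[symmetric] divide_inverse)
  ultimately have *: "(\<lambda>k. (1 / fact k) *\<^sub>R mpow A k) sums apply_to_one (exp (lmul A))"
    by simp
  then have "mexp A = apply_to_one (exp (lmul A))"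
    unfolding mexp_def by (rule sums_unique[symmetric])
  with * show ?thesis
    by simp
qed

lemma lmul_mexp: "lmul (mexp A) = exp (lmul A)"
proof -
  have "(\<lambda>k. lmul ((1 / fact k) *\<^sub>R mpow A k)) sums lmul (mexp A)"
    by (rule bounded_linear.sums[OF bounded_linear_lmul mexp_sums])
  then have "(\<lambda>k. lmul A ^ k /\<^sub>R fact k) sums lmul (mexp A)"
    by (simp add: linear_simps(5)[OF bounded_linear_lmul] lmul_mpow divide_inverse)
  then show ?thesis
    using exp_converges sums_unique2 by blast
qed

lemma mexp_add_commuting:
  assumes "A ** B = B ** A"
  shows "mexp (A + B) = mexp A ** mexp B"
proof -
  have "lmul A * lmul B = lmul B * lmul A"
    using assms by (simp flip: lmul_mult)
  then show ?thesis
    by (intro lmul_inject[THEN iffD1])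
      (simp add: lmul_mexp lmul_mult linear_simps(1)[OF bounded_linear_lmul] exp_add_commuting)
qed

lemma mexp_zero [simp]: "mexp 0 = mat 1"
  by (intro lmul_inject[THEN iffD1])
    (simp add: lmul_mexp lmul_one linear_simps(3)[OF bounded_linear_lmul])

lemma mexp_scaleR_has_vector_derivative:
  "((\<lambda>t. mexp (t *\<^sub>R A)) has_vector_derivative mexp (t *\<^sub>R A) ** A) (at t)"
proof -
  have exp_lmul: "exp (s *\<^sub>R lmul A) = lmul (mexp (s *\<^sub>R A))" for s
    by (simp add: lmul_mexp linear_simps(5)[OF bounded_linear_lmul])
  have "((\<lambda>t. apply_to_one (exp (t *\<^sub>R lmul A))) has_vector_derivative
      apply_to_one (exp (t *\<^sub>R lmul A) * lmul A)) (at t)"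
    by (rule bounded_linear.has_vector_derivative[OF bounded_linear_apply_to_one
          exp_scaleR_has_vector_derivative_right])
  then show ?thesis
    by (simp only: exp_lmul lmul_mult[symmetric] apply_to_one_lmul)
qed

lemma mexp_scaleR_has_vector_derivative_zero:
  "((\<lambda>t. mexp (t *\<^sub>R A)) has_vector_derivative A) (at 0)"
  using mexp_scaleR_has_vector_derivative[of A 0] by simp

lemma mexp_mult_mexp_uminus: "mexp A ** mexp (- A) = mat 1"
proof -
  have "A ** (- A) = (- A) ** A"
    by (simp add: bounded_bilinear.minus_left[OF bounded_bilinear_matrix_mult]
        bounded_bilinear.minus_right[OF bounded_bilinear_matrix_mult])
  from mexp_add_commuting[OF this] show ?thesis
    by simp
qed

section \<open>Conjugate transposes and diagonal matrices\<close>

lemma adj_adj [simp]: "adj (adj A) = A"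
  by (simp add: adj_def vec_eq_iff)

lemma adj_mult: "adj (A ** B) = adj B ** adj A"
  by (simp add: adj_def vec_eq_iff matrix_matrix_mult_def mult.commute)

lemma adj_mat_one [simp]: "adj (mat 1) = mat 1"
  by (simp add: adj_def vec_eq_iff mat_def)

lemma bounded_linear_adj: "bounded_linear adj"
  unfolding linear_conv_bounded_linear[symmetric]
  by (rule linearI) (simp_all add: adj_def vec_eq_iff)

lemma mpow_commute: "mpow A k ** A = A ** mpow A k"
  by (induction k) (simp_all flip: matrix_mul_assoc)

lemma adj_mpow: "adj (mpow A k) = mpow (adj A) k"
  by (induction k) (simp_all add: adj_mult mpow_commute)

lemma adj_mexp: "adj (mexp A) = mexp (adj A)"
proof -
  have "(\<lambda>k. adj ((1 / fact k) *\<^sub>R mpow A k)) sums adj (mexp A)"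
    by (rule bounded_linear.sums[OF bounded_linear_adj mexp_sums])
  then have "(\<lambda>k. (1 / fact k) *\<^sub>R mpow (adj A) k) sums adj (mexp A)"
    by (simp add: linear_simps(5)[OF bounded_linear_adj] adj_mpow)
  with mexp_sums show ?thesis
    using sums_unique2 by blast
qed

lemma mexp_anti_hermitian_unitary:
  assumes "adj A = - A"
  shows "mexp A \<in> unitary" and "adj (mexp A) = mexp (- A)"
proof -
  show adj_exp: "adj (mexp A) = mexp (- A)"
    by (simp add: adj_mexp assms)
  have "mexp (- A) ** mexp A = mat 1"
    using mexp_mult_mexp_uminus[of "- A"] by simp
  with mexp_mult_mexp_uminus[of A] show "mexp A \<in> unitary"
    by (simp add: unitary_def adj_exp)
qed

lemma dmat_entry: "dmat v $ i $ j = (if i = j then complex_of_real (v $ i) else 0)"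
  by (simp add: dmat_def)

lemma dmat_mult_entry: "(dmat u ** A) $ i $ j = complex_of_real (u $ i) * A $ i $ j"
  by (simp add: matrix_matrix_mult_def dmat_entry if_distrib if_distribR sum.delta cong: if_cong)

lemma mult_dmat_entry: "(A ** dmat u) $ i $ j = A $ i $ j * complex_of_real (u $ j)"
  by (simp add: matrix_matrix_mult_def dmat_entry if_distrib if_distribR sum.delta' cong: if_cong)

lemma dmat_mult_dmat: "dmat u ** dmat v = dmat (\<chi> i. u $ i * v $ i)"
  by (simp add: vec_eq_iff dmat_mult_entry dmat_entry)

lemma dmat_one: "dmat (\<chi> i. 1) = mat 1"
  by (simp add: dmat_def mat_def vec_eq_iff)

lemma bounded_linear_dmat: "bounded_linear dmat"
  unfolding linear_conv_bounded_linear[symmetric]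
  by (rule linearI) (simp_all add: vec_eq_iff dmat_entry of_real_def scaleR_add_left)

lemma mpow_dmat: "mpow (dmat v) k = dmat (\<chi> i. v $ i ^ k)"
  by (induction k) (simp_all add: dmat_one dmat_mult_dmat)

lemma mexp_dmat: "mexp (dmat v) = dmat (\<chi> i. exp (v $ i))"
proof -
  let ?term = "\<lambda>i j k. ((1 / fact k) *\<^sub>R mpow (dmat v) k) $ i $ j"
  have "(\<lambda>k. ?term i j k) sums (mexp (dmat v) $ i $ j)" for i j
    by (rule bounded_linear.sums[OF bounded_linear_compose[OF bounded_linear_vec_nth
          bounded_linear_vec_nth] mexp_sums])
  moreover have "(\<lambda>k. ?term i j k) sums (dmat (\<chi> i. exp (v $ i)) $ i $ j)" for i j
  proof (cases "i = j")
    case True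
    have "(\<lambda>k. ?term i j k) = (\<lambda>k. of_real (v $ i ^ k /\<^sub>R fact k))"
      using True by (simp add: mpow_dmat dmat_entry of_real_def divide_inverse)
    moreover have "dmat (\<chi> i. exp (v $ i)) $ i $ j = of_real (exp (v $ i))"
      using True by (simp add: dmat_entry)
    ultimately show ?thesis
      by (simp only: sums_of_real[OF exp_converges])
  next
    case False
    then show ?thesis
      by (simp add: mpow_dmat dmat_entry)
  qed
  ultimately show ?thesis
    unfolding vec_eq_iff using sums_unique2 by blast
qed

lemma mexp_dmat_add: "mexp (dmat (u + v)) = mexp (dmat u) ** mexp (dmat v)"
  by (simp add: mexp_dmat dmat_mult_dmat exp_add)

section \<open>The trace pairing\<close>

lemma inner_adj_adj: "inner (adj A) (adj B) = inner A B"
  unfolding inner_vec_def adj_def inner_complex_def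
  by simp (rule sum.swap)

lemma pair_eq_inner_adj: "pair A B = inner (adj A) B"
  unfolding pair_def mtrace_def matrix_matrix_mult_def inner_vec_def adj_def inner_complex_def
  by (simp add: Re_sum) (rule sum.swap)

lemma pair_commute: "pair A B = pair B A"
  using trace_mul_sym[of A B] by (simp add: pair_def mtrace_def trace_def)

lemma pair_mult_assoc: "pair (A ** B) C = pair A (B ** C)"
  by (simp add: pair_def matrix_mul_assoc)

lemma pair_diff_left: "pair (A - B) C = pair A C - pair B C"
  and pair_diff_right: "pair A (B - C) = pair A B - pair A C"
  by (simp_all add: pair_eq_inner_adj linear_simps(2)[OF bounded_linear_adj] inner_diff_left inner_diff_right)

lemma pair_scaleR_left: "pair (r *\<^sub>R A) B = r * pair A B"
  by (simp add: pair_eq_inner_adj linear_simps(5)[OF bounded_linear_adj])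

lemma pair_eqI:
  assumes "\<And>X. pair A X = pair B X"
  shows "A = B"
proof -
  have "inner (adj A - adj B) X = 0" for X
    using assms[of X] by (simp add: pair_eq_inner_adj inner_diff_left)
  then have "adj A = adj B"
    by (metis inner_eq_zero_iff right_minus_eq)
  then show ?thesis
    by (metis adj_adj)
qed

lemma linear_functional_eq_pair:
  assumes "linear L"
  shows "\<exists>Y. \<forall>X. L X = pair Y X"
proof
  show "\<forall>X. L X = pair (adj (adjoint L 1)) X"
    using adjoint_works[OF assms, of _ 1] by (simp add: pair_eq_inner_adj inner_commute)
qed

lemma bounded_linear_pair_representation:
  fixes L :: "'n::finite cmat \<times> 'n cmat \<Rightarrow> real" and g :: "'n cmat"
  assumes "bounded_linear L"
  obtains Z Y where "\<And>X. L (X ** g, 0) = pair Z X" and "\<And>X. L (0, X) = pair Y X"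
proof -
  have "bounded_linear (\<lambda>X. L (X ** g, 0))" and "bounded_linear (\<lambda>X. L (0, X))"
    by (intro bounded_linear_compose[OF assms] bounded_linear_Pair bounded_linear_zero
        bounded_linear_ident bounded_linear_matrix_mult_left)+
  with linear_functional_eq_pair that show ?thesis
    by (metis bounded_linear.linear)
qed

lemma pair_comm_swap: "pair A (comm B C) = - pair (comm A C) B"
proof -
  have "pair (C ** A) B = pair A (B ** C)"
    by (metis pair_commute pair_mult_assoc)
  then show ?thesis
    by (simp add: comm_def pair_diff_left pair_diff_right pair_mult_assoc)
qed

lemma pair_cyclic:
  fixes G H Y Z :: "'n::finite cmat"
  shows "pair Z (G ** Y ** H) = pair (H ** Z ** G) Y"
proof -
  have "pair Z (G ** Y ** H) = pair (Z ** (G ** Y)) H"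
    by (simp only: pair_mult_assoc)
  also have "\<dots> = pair H (Z ** (G ** Y))"
    by (rule pair_commute)
  also have "\<dots> = pair (H ** Z ** G) Y"
    by (simp only: pair_mult_assoc)
  finally show ?thesis .
qed

lemma adj_pplus: "adj (pplus A) = - pplus A"
  by (simp add: pplus_def linear_simps[OF bounded_linear_adj] algebra_simps)

lemma pplus_diff: "pplus (A - B) = pplus A - pplus B"
  by (simp add: pplus_def linear_simps[OF bounded_linear_adj] algebra_simps)

lemma pair_pplus_anti_hermitian:
  assumes "adj Y = - Y"
  shows "pair (pplus A) Y = pair A Y"
proof -
  have "pair (adj A) Y = - pair A Y"
    by (metis pair_eq_inner_adj inner_adj_adj adj_adj assms inner_minus_right)
  then show ?thesis
    by (simp add: pplus_def pair_scaleR_left pair_diff_left)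
qed

lemma pplus_eqI:
  assumes "\<And>Y. adj Y = - Y \<Longrightarrow> pair A Y = pair B Y"
  shows "pplus A = pplus B"
proof -
  define P where "P = pplus A - pplus B"
  have adj_P: "adj P = - P"
    by (simp add: P_def adj_pplus linear_simps(2)[OF bounded_linear_adj])
  have "pair P P = pair A P - pair B P"
    by (simp add: P_def pair_diff_left pair_pplus_anti_hermitian[OF adj_P, unfolded P_def])
  then have "pair P P = 0"
    using assms[OF adj_P] by simp
  then have "inner P P = 0"
    by (simp add: pair_eq_inner_adj adj_P)
  then show ?thesis
    by (simp add: P_def)
qed

lemma pplus_entry: "pplus A $ i $ j = (A $ i $ j - cnj (A $ j $ i)) / 2"
  by (simp add: pplus_def adj_def complex_eq_iff)

lemma pair_dmat: "pair A (dmat x) = inner (\<chi> i. Re (A $ i $ i)) x"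
  by (simp add: pair_def mtrace_def mult_dmat_entry inner_vec_def Re_sum)

section \<open>Gradients as derivatives along curves\<close>

lemma has_real_derivative_along_curve:
  fixes F :: "'a::real_normed_vector \<Rightarrow> real"
  assumes "(F has_derivative L) (at (\<gamma> t))" and "(\<gamma> has_vector_derivative v) (at t)"
  shows "((\<lambda>s. F (\<gamma> s)) has_real_derivative L v) (at t)"
  using vector_derivative_diff_chain_within[OF assms(2) has_derivative_at_withinI[OF assms(1)]]
  by (simp add: o_def has_real_derivative_iff_has_vector_derivative)

lemma derivative_vanishes_along_level_curve:
  fixes F :: "'a::real_normed_vector \<Rightarrow> real"
  assumes "(F has_derivative L) (at (\<gamma> 0))" and "(\<gamma> has_vector_derivative v) (at 0)"
    and "\<And>t. F (\<gamma> t) = F (\<gamma> 0)"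
  shows "L v = 0"
proof -
  have "(\<lambda>s. F (\<gamma> s)) = (\<lambda>s. F (\<gamma> 0))"
    by (rule ext) (rule assms(3))
  then have "((\<lambda>s. F (\<gamma> s)) has_real_derivative 0) (at 0)"
    by simp
  with has_real_derivative_along_curve[OF assms(1,2)] show ?thesis
    by (rule DERIV_unique)
qed

lemma has_real_derivative_left_translation:
  assumes "(F has_derivative L) (at (g, J))"
  shows "((\<lambda>t. F (mexp (t *\<^sub>R X) ** g, J)) has_real_derivative L (X ** g, 0)) (at 0)"
proof (rule has_real_derivative_along_curve[where \<gamma> = "\<lambda>t. (mexp (t *\<^sub>R X) ** g, J)"])
  show "(F has_derivative L) (at (mexp (0 *\<^sub>R X) ** g, J))"
    using assms by simp
  show "((\<lambda>t. (mexp (t *\<^sub>R X) ** g, J)) has_vector_derivative (X ** g, 0)) (at 0)"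
    by (rule has_vector_derivative_Pair[OF
          bounded_linear.has_vector_derivative[OF bounded_linear_matrix_mult_left
            mexp_scaleR_has_vector_derivative_zero]
          has_vector_derivative_const])
qed

lemma the_pair_gradient_eq:
  assumes "\<And>X. (\<phi> X has_real_derivative pair Z X) (at 0)"
  shows "(THE Y. \<forall>X. (\<phi> X has_real_derivative pair Y X) (at 0)) = Z"
proof (rule the_equality)
  show "\<forall>X. (\<phi> X has_real_derivative pair Z X) (at 0)"
    using assms by blast
  show "Y = Z" if Y: "\<forall>X. (\<phi> X has_real_derivative pair Y X) (at 0)" for Y
    using DERIV_unique[OF Y[rule_format] assms] by (rule pair_eqI)
qed

lemma nabla1_eq:
  assumes "(F has_derivative L) (at (g, J))" and "\<And>X. L (X ** g, 0) = pair Z X"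
  shows "nabla1 F g J = Z"
  unfolding nabla1_def
  by (rule the_pair_gradient_eq) (use has_real_derivative_left_translation[OF assms(1)] assms(2) in simp)

lemma d2_eq:
  assumes "(F has_derivative L) (at (g, J))" and "\<And>J'. f q J' = F (g, J')"
    and "\<And>X. L (0, X) = pair Y X"
  shows "d2 f q J = Y"
  unfolding d2_def
proof (rule the_pair_gradient_eq)
  fix X
  have "((\<lambda>t. F (g, J + t *\<^sub>R X)) has_real_derivative L (0, X)) (at 0)"
    by (rule has_real_derivative_along_curve[where \<gamma> = "\<lambda>t. (g, J + t *\<^sub>R X)"])
      (use assms(1) in \<open>auto intro!: derivative_eq_intros\<close>)
  with assms(2,3) show "((\<lambda>t. f q (J + t *\<^sub>R X)) has_real_derivative pair Y X) (at 0)"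
    by simp
qed

lemma eventually_regular_nhds:
  assumes "regular q"
  shows "eventually regular (nhds q)"
proof -
  have pair_ev: "eventually (\<lambda>p. i < j \<longrightarrow> p $ j < p $ i) (nhds q)" for i j
  proof (cases "i < j")
    case True
    have "((\<lambda>p. p $ i - p $ j) \<longlongrightarrow> q $ i - q $ j) (nhds q)"
      by (intro tendsto_intros filterlim_ident)
    moreover have "0 < q $ i - q $ j"
      using assms True by (simp add: regular_def)
    ultimately show ?thesis
      by (rule order_tendstoD(1)[THEN eventually_mono]) simp
  qed simp
  have "eventually (\<lambda>p. \<forall>j. i < j \<longrightarrow> p $ j < p $ i) (nhds q)" for i
    by (rule eventually_all_finite) (rule pair_ev)
  then show ?thesis
    unfolding regular_def by (rule eventually_all_finite)
qed

lemma has_real_derivative_diagonal_direction: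
  assumes "(F has_derivative L) (at (mexp (dmat q), J))" and "regular q"
    and "\<forall>q' J'. regular q' \<longrightarrow> f q' J' = F (mexp (dmat q'), J')"
    and "\<And>X. L (X ** mexp (dmat q), 0) = pair Z X"
  shows "((\<lambda>t. f (q + t *\<^sub>R x) J) has_real_derivative inner (\<chi> i. Re (Z $ i $ i)) x) (at 0)"
proof -
  have "((\<lambda>t. q + t *\<^sub>R x) \<longlongrightarrow> q + 0 *\<^sub>R x) (nhds 0)"
    by (intro tendsto_intros filterlim_ident)
  then have "eventually (\<lambda>t. regular (q + t *\<^sub>R x)) (nhds 0)"
    using eventually_compose_filterlim[OF eventually_regular_nhds[OF assms(2)]] by simp
  moreover have "mexp (dmat (q + t *\<^sub>R x)) = mexp (t *\<^sub>R dmat x) ** mexp (dmat q)" for t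
    using mexp_dmat_add[of "t *\<^sub>R x" q]
    by (simp add: add.commute linear_simps(5)[OF bounded_linear_dmat])
  ultimately have "eventually (\<lambda>t.
      f (q + t *\<^sub>R x) J = F (mexp (t *\<^sub>R dmat x) ** mexp (dmat q), J)) (nhds 0)"
    by (auto elim: eventually_mono simp: assms(3))
  moreover have "((\<lambda>t. F (mexp (t *\<^sub>R dmat x) ** mexp (dmat q), J)) has_real_derivative
      inner (\<chi> i. Re (Z $ i $ i)) x) (at 0)"
    using has_real_derivative_left_translation[OF assms(1), of "dmat x"] unfolding assms(4) pair_dmat .
  ultimately show ?thesis
    by (simp add: DERIV_cong_ev)
qed

lemma nabla1_0_eq:
  assumes "\<And>x. ((\<lambda>t. f (q + t *\<^sub>R x) J) has_real_derivative inner v x) (at 0)"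
  shows "nabla1_0 f q J = dmat v"
proof -
  let ?grad = "\<lambda>Y. \<forall>x. ((\<lambda>t. f (q + t *\<^sub>R x) J) has_real_derivative pair Y (dmat x)) (at 0)"
  show ?thesis
    unfolding nabla1_0_def
  proof (rule the_equality)
    show "dmat v \<in> diagH \<and> ?grad (dmat v)"
      using assms by (simp add: diagH_def pair_dmat dmat_entry)
    fix Y
    assume "Y \<in> diagH \<and> ?grad Y"
    then obtain w where "Y = dmat w"
      and "\<forall>x. ((\<lambda>t. f (q + t *\<^sub>R x) J) has_real_derivative inner w x) (at 0)"
      by (auto simp: diagH_def pair_dmat dmat_entry)
    with assms have "w = v"
      by (metis DERIV_unique vector_eq_rdot)
    with \<open>Y = dmat w\<close> show "Y = dmat v"
      by simp
  qed
qed

section \<open>Consequences of the invariance\<close>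

lemma smooth_on_has_derivative: "smooth_on S f \<Longrightarrow> x \<in> S \<Longrightarrow> \<exists>f'. (f has_derivative f') (at x)"
  by (erule smooth_on.cases) blast

lemma anti_hermitian_scaleR: "adj A = - A \<Longrightarrow> adj (t *\<^sub>R A) = - (t *\<^sub>R A)"
  by (simp add: linear_simps(5)[OF bounded_linear_adj])

lemma inv_smooth_invariant:
  assumes "F \<in> inv_smooth" and "(g, J) \<in> MM" and "\<eta> \<in> unitary"
  shows "F (g ** adj \<eta>, J) = F (g, J)" and "F (\<eta> ** g, \<eta> ** J ** adj \<eta>) = F (g, J)"
  using assms unfolding inv_smooth_def by fastforce+

lemma inv_smooth_derivative_left_orbit:
  assumes "F \<in> inv_smooth" and "(g, J) \<in> MM" and "(F has_derivative L) (at (g, J))"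
    and "adj Y = - Y"
  shows "L (Y ** g, comm Y J) = 0"
proof (rule derivative_vanishes_along_level_curve[where
      \<gamma> = "\<lambda>t. (mexp (t *\<^sub>R Y) ** g, mexp (t *\<^sub>R Y) ** J ** mexp (t *\<^sub>R (- Y)))"])
  show "(F has_derivative L) (at (mexp (0 *\<^sub>R Y) ** g, mexp (0 *\<^sub>R Y) ** J ** mexp (0 *\<^sub>R (- Y))))"
    using assms(3) by simp
  have "((\<lambda>t. mexp (t *\<^sub>R Y) ** J ** mexp (t *\<^sub>R (- Y))) has_vector_derivative
      mexp (0 *\<^sub>R Y) ** J ** (- Y) + Y ** J ** mexp (0 *\<^sub>R (- Y))) (at 0)"
    by (rule bounded_bilinear.has_vector_derivative[OF bounded_bilinear_matrix_mult
          bounded_linear.has_vector_derivative[OF bounded_linear_matrix_mult_left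
            mexp_scaleR_has_vector_derivative_zero]
          mexp_scaleR_has_vector_derivative_zero])
  then show "((\<lambda>t. (mexp (t *\<^sub>R Y) ** g, mexp (t *\<^sub>R Y) ** J ** mexp (t *\<^sub>R (- Y))))
      has_vector_derivative (Y ** g, comm Y J)) (at 0)"
    by (auto intro!: has_vector_derivative_Pair
        bounded_linear.has_vector_derivative[OF bounded_linear_matrix_mult_left
          mexp_scaleR_has_vector_derivative_zero]
        simp: comm_def bounded_bilinear.minus_right[OF bounded_bilinear_matrix_mult])
  show "F (mexp (t *\<^sub>R Y) ** g, mexp (t *\<^sub>R Y) ** J ** mexp (t *\<^sub>R (- Y))) =
      F (mexp (0 *\<^sub>R Y) ** g, mexp (0 *\<^sub>R Y) ** J ** mexp (0 *\<^sub>R (- Y)))" for t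
  proof -
    note unitary = mexp_anti_hermitian_unitary[OF anti_hermitian_scaleR[OF assms(4)], of t]
    show ?thesis
      using inv_smooth_invariant(2)[OF assms(1,2) unitary(1)] unitary(2) by simp
  qed
qed

lemma inv_smooth_derivative_right_orbit:
  assumes "F \<in> inv_smooth" and "(g, J) \<in> MM" and "(F has_derivative L) (at (g, J))"
    and "adj Y = - Y"
  shows "L (g ** Y, 0) = 0"
proof (rule derivative_vanishes_along_level_curve[where \<gamma> = "\<lambda>t. (g ** mexp (t *\<^sub>R Y), J)"])
  show "(F has_derivative L) (at (g ** mexp (0 *\<^sub>R Y), J))"
    using assms(3) by simp
  show "((\<lambda>t. (g ** mexp (t *\<^sub>R Y), J)) has_vector_derivative (g ** Y, 0)) (at 0)"
    by (rule has_vector_derivative_Pair[OF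
          bounded_linear.has_vector_derivative[OF bounded_linear_matrix_mult_right
            mexp_scaleR_has_vector_derivative_zero]
          has_vector_derivative_const])
  show "F (g ** mexp (t *\<^sub>R Y), J) = F (g ** mexp (0 *\<^sub>R Y), J)" for t
  proof -
    have "adj (- (t *\<^sub>R Y)) = - (- (t *\<^sub>R Y))"
      using anti_hermitian_scaleR[OF assms(4)] by (simp add: linear_simps(4)[OF bounded_linear_adj])
    note unitary = mexp_anti_hermitian_unitary[OF this]
    show ?thesis
      using inv_smooth_invariant(1)[OF assms(1,2) unitary(1)] unitary(2) by simp
  qed
qed

section \<open>Solving for the gradient\<close>

lemma coth_exp: "coth d = (exp d ^ 2 + 1) / (exp d ^ 2 - 1)"
proof -
  have "exp d > 0" and "exp (- d) = 1 / exp d"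
    by (simp_all add: exp_minus divide_inverse)
  then have "cosh d = (exp d ^ 2 + 1) / (2 * exp d)" and "sinh d = (exp d ^ 2 - 1) / (2 * exp d)"
    by (simp_all add: cosh_def sinh_def field_simps power2_eq_square)
  with \<open>exp d > 0\<close> show ?thesis
    by (simp add: coth_def)
qed

lemma one_plus_coth_solution:
  fixes a b p :: complex and d :: real
  assumes "d \<noteq> 0" and "a * exp (- d) = b * exp d" and "a - b = 2 * p"
  shows "a = p * (1 + coth d)"
proof -
  define u where "u = exp d"
  have "u > 0"
    by (simp add: u_def)
  moreover have "u \<noteq> 1"
    using assms(1) by (simp add: u_def)
  ultimately have "u ^ 2 \<noteq> 1"
    by (auto simp: power2_eq_1_iff)
  have "b = a / u ^ 2"
    using assms(2) \<open>u > 0\<close> by (simp add: u_def exp_minus field_simps power2_eq_square)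
  with assms(3) have "a * (u ^ 2 - 1) = 2 * p * u ^ 2"
    using \<open>u > 0\<close> by (simp add: field_simps)
  moreover have "(complex_of_real u) ^ 2 - 1 \<noteq> 0"
    using \<open>u ^ 2 \<noteq> 1\<close> by (metis of_real_1 of_real_eq_iff of_real_power right_minus_eq)
  ultimately show ?thesis
    by (simp add: coth_exp flip: u_def) (simp add: field_simps)
qed

lemma dmat_mult_mult_dmat_entry:
  "(dmat u ** A ** dmat w) $ i $ j = of_real (u $ i) * A $ i $ j * of_real (w $ j)"
  by (simp add: dmat_mult_entry mult_dmat_entry)

lemma eq_from_anti_hermitian_parts:
  fixes Z C :: "'n::finite cmat"
  assumes Z: "pplus Z = pplus C"
    and twisted: "pplus (mexp (- dmat q) ** Z ** mexp (dmat q)) = 0"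
    and distinct: "\<And>i j. i \<noteq> j \<Longrightarrow> q $ i \<noteq> q $ j"
  shows "Z = pplus C + dmat (\<chi> i. Re (Z $ i $ i)) + Rq q (pplus C)"
proof -
  have "Z $ i $ j = (pplus C + dmat (\<chi> i. Re (Z $ i $ i)) + Rq q (pplus C)) $ i $ j" for i j
  proof (cases "i = j")
    case True
    then show ?thesis
      unfolding Z[symmetric] by (simp add: Rq_def dmat_entry pplus_entry complex_eq_iff)
  next
    case False
    define d where "d = q $ i - q $ j"
    have "Z $ i $ j - cnj (Z $ j $ i) = 2 * pplus C $ i $ j"
      unfolding Z[symmetric] by (simp add: pplus_entry)
    moreover have "Z $ i $ j * exp (- d) = cnj (Z $ j $ i) * exp d"
    proof -
      have "mexp (- dmat q) = dmat (\<chi> i. exp (- q $ i))"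
        using mexp_dmat[of "- q"] by (simp add: linear_simps[OF bounded_linear_dmat])
      with twisted
      have "pplus (dmat (\<chi> i. exp (- q $ i)) ** Z ** dmat (\<chi> i. exp (q $ i))) $ i $ j = 0"
        by (simp add: mexp_dmat)
      then show ?thesis
        by (simp add: pplus_entry dmat_mult_mult_dmat_entry d_def exp_diff exp_minus field_simps)
    qed
    ultimately have "Z $ i $ j = pplus C $ i $ j * (1 + coth d)"
      using distinct[OF False] by (intro one_plus_coth_solution) (simp_all add: d_def)
    then show ?thesis
      using False by (simp add: Rq_def dmat_entry d_def distrib_left)
  qed
  then show ?thesis
    unfolding vec_eq_iff by blast
qed

lemma invertible_mexp: "invertible (mexp A)"
  unfolding invertible_def using mexp_mult_mexp_uminus[of A] mexp_mult_mexp_uminus[of "- A"] by auto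

lemma regular_imp_distinct: "regular q \<Longrightarrow> i \<noteq> j \<Longrightarrow> q $ i \<noteq> q $ j"
  unfolding regular_def by (metis neq_iff order_less_irrefl)

lemma inv_smooth_pplus_gradient:
  fixes g J Y Z :: "'n::finite cmat"
  assumes "F \<in> inv_smooth" and "(g, J) \<in> MM" and L: "(F has_derivative L) (at (g, J))"
    and Z: "\<And>X. L (X ** g, 0) = pair Z X" and Y: "\<And>X. L (0, X) = pair Y X"
  shows "pplus Z = pplus (comm Y J)"
proof (rule pplus_eqI)
  fix W :: "'n cmat"
  assume "adj W = - W"
  have "L (W ** g, comm W J) = L (W ** g, 0) + L (0, comm W J)"
    using linear_add[OF has_derivative_linear[OF L], of "(W ** g, 0)" "(0, comm W J)"] by simp
  with inv_smooth_derivative_left_orbit[OF assms(1-3) \<open>adj W = - W\<close>]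
  show "pair Z W = pair (comm Y J) W"
    by (simp add: Z Y pair_comm_swap)
qed

lemma inv_smooth_pplus_conj_gradient:
  fixes g g' J Z :: "'n::finite cmat"
  assumes "F \<in> inv_smooth" and "(g, J) \<in> MM" and "(F has_derivative L) (at (g, J))"
    and Z: "\<And>X. L (X ** g, 0) = pair Z X" and inv: "g' ** g = mat 1"
  shows "pplus (g' ** Z ** g) = 0"
proof -
  have "pplus (g' ** Z ** g) = pplus 0"
  proof (rule pplus_eqI)
    fix W :: "'n cmat"
    assume "adj W = - W"
    have "pair (g' ** Z ** g) W = pair Z (g ** W ** g')"
      by (rule pair_cyclic[symmetric])
    also have "\<dots> = L (g ** W, 0)"
      by (simp add: Z[symmetric] inv flip: matrix_mul_assoc)
    also have "\<dots> = 0"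
      by (rule inv_smooth_derivative_right_orbit[OF assms(1-3) \<open>adj W = - W\<close>])
    finally show "pair (g' ** Z ** g) W = pair 0 W"
      by (simp add: pair_def mtrace_def)
  qed
  then show ?thesis
    using pplus_diff[of 0 0] by simp
qed

theorem lemma3p3:
  fixes F :: "('n::{finite,linorder}) cmat \<times> 'n cmat \<Rightarrow> real"
    and f :: "'n rvec \<Rightarrow> 'n cmat \<Rightarrow> real"
    and q :: "'n rvec" and J :: "'n cmat"
  assumes "F \<in> inv_smooth"
    and "\<forall>q' J'. regular q' \<longrightarrow> f q' J' = F (mexp (dmat q'), J')"
    and "regular q"
  shows "nabla1 F (mexp (dmat q)) J =
           pplus (comm (d2 f q J) J) + nabla1_0 f q J + Rq q (pplus (comm (d2 f q J) J))"
proof -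
  define g where "g = mexp (dmat q)"
  have gJ: "(g, J) \<in> MM"
    by (simp add: MM_def g_def invertible_mexp)
  obtain L where L: "(F has_derivative L) (at (g, J))"
    using assms(1) gJ smooth_on_has_derivative unfolding inv_smooth_def by blast
  obtain Z Y where Z: "\<And>X. L (X ** g, 0) = pair Z X" and Y: "\<And>X. L (0, X) = pair Y X"
    using bounded_linear_pair_representation[OF has_derivative_bounded_linear[OF L], of g] by blast
  have "nabla1 F g J = Z"
    using L Z by (rule nabla1_eq)
  moreover have "d2 f q J = Y"
    using L assms(2,3) Y by (intro d2_eq) (simp_all add: g_def)
  moreover have "nabla1_0 f q J = dmat (\<chi> i. Re (Z $ i $ i))"
    using L assms(3,2) Z unfolding g_def by (intro nabla1_0_eq has_real_derivative_diagonal_direction)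
  moreover have "Z = pplus (comm Y J) + dmat (\<chi> i. Re (Z $ i $ i)) + Rq q (pplus (comm Y J))"
  proof (rule eq_from_anti_hermitian_parts)
    show "pplus Z = pplus (comm Y J)"
      by (rule inv_smooth_pplus_gradient[OF assms(1) gJ L Z Y])
    show "pplus (mexp (- dmat q) ** Z ** mexp (dmat q)) = 0"
      using inv_smooth_pplus_conj_gradient[OF assms(1) gJ L Z] mexp_mult_mexp_uminus[of "- dmat q"]
      by (simp add: g_def)
  qed (rule regular_imp_distinct[OF assms(3)])
  ultimately show ?thesis
    by (simp add: g_def)
qed

end
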